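(* Consider the single-agent contract problem with safety inspections described in the context, and suppose that $c_1<\dots<c_n$, $R_1<\dots<R_n$ (Assumption 1) and $\max_i(R_i-c_i)>\kappa_S$ (Assumption 2). Then the minimal inspection probability $\beta(\gamma)$, $\gamma\in[\gamma_1,1]$, is a (weakly) decreasing function of $\gamma$. Moreover, it is strictly decreasing when $\beta(\gamma)>0$ (i.e. on the set of $\gamma$ where $\beta(\gamma)>0$).
   Context: Single-agent model. An agent chooses an action $(a_i,s)$ with $i\in[n]:=\{1,\dots,n\}$ and $s\in\{0,1\}$. Actions with $s=1$ are called safe, actions with $s=0$ unsafe. Effort $a_i$ costs the agent $c_i\ge 0$ and taking $s=1$ costs an additional $\kappa_S\ge 0$. Effort $a_i$ has expected (nonnegative) reward $R_i\ge 0$ for the principal when the action is safe. When the action is unsafe, negative side effects (reward $-\infty$) occur with probability $\alpha\in(0,1]$. A linear contract is a pair $(\gamma,\beta)\in[0,1]^2$: $\gamma$ is the fraction of the reward paid to the agent (nothing is paid if side effects occur), and $\beta$ is the probability of an inspection that reveals $s$ (nothing is paid if the inspection reveals an unsafe action; inspection is independent of side effects). The agent's expected utility under $(\gamma,\beta)$ is $$\mathcal U_a(a_i,1)=\gamma R_i-c_i-\kappa_S,\qquad \mathcal U_a(a_i,0)=(1-\beta)(1-\alpha)\gamma R_i-c_i .$$ The contract $(\gamma,\beta)$ implements the action $(a_i,s)$ if (IC) $\mathcal U_a(a_i,s)\ge \mathcal U_a(a_j,s')$ for all $j\in[n]$, $s'\in\{0,1\}$, and (IR) $\mathcal U_a(a_i,s)\ge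 0$. Notation. For $\gamma\in[0,1]$ let $u_h(\gamma)=\max_{i\in[n]}(\gamma R_i-c_i)$, and let $\gamma_1:=u_h^{-1}(\kappa_S)$ be the point with $u_h(\gamma_1)=\kappa_S$; no safe action is implementable with $\gamma<\gamma_1$. For $\gamma\in[\gamma_1,1]$, $\beta(\gamma)\in[0,1]$ denotes the number such that $(\gamma,\beta)$ (with $\beta\in[0,1]$) implements some safe action if and only if $\beta\ge\beta(\gamma)$. *)

theory Defs
  imports "HOL-Analysis.Analysis"
begin

text \<open>
  Parameters: effort levels \<open>{1..n}\<close> with cost \<open>c i\<close> and expected reward \<open>R i\<close>, cost
  \<open>\<kappa>\<close> of acting safely, side-effect probability \<open>\<alpha>\<close>. A contract is a pair
  \<open>(\<gamma>, \<beta>)\<close> of reward share and inspection probability. An action is a pair \<open>(i, s)\<close>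
  of effort and safety, where \<open>s = True\<close> means safe.
\<close>

fun agent_utility ::
  "(nat \<Rightarrow> real) \<Rightarrow> (nat \<Rightarrow> real) \<Rightarrow> real \<Rightarrow> real \<Rightarrow> real \<times> real \<Rightarrow> nat \<times> bool \<Rightarrow> real"
where
  "agent_utility c R \<kappa> \<alpha> (\<gamma>, \<beta>) (i, True) = \<gamma> * R i - c i - \<kappa>"
| "agent_utility c R \<kappa> \<alpha> (\<gamma>, \<beta>) (i, False) = (1 - \<beta>) * (1 - \<alpha>) * \<gamma> * R i - c i"

definition implements ::
  "nat \<Rightarrow> (nat \<Rightarrow> real) \<Rightarrow> (nat \<Rightarrow> real) \<Rightarrow> real \<Rightarrow> real \<Rightarrow> real \<times> real \<Rightarrow> nat \<times> bool \<Rightarrow> bool"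
where
  "implements n c R \<kappa> \<alpha> C a \<longleftrightarrow>
     (\<forall>j\<in>{1..n}. \<forall>s. agent_utility c R \<kappa> \<alpha> C a \<ge> agent_utility c R \<kappa> \<alpha> C (j, s)) \<and>
     agent_utility c R \<kappa> \<alpha> C a \<ge> 0"

definition u_h :: "nat \<Rightarrow> (nat \<Rightarrow> real) \<Rightarrow> (nat \<Rightarrow> real) \<Rightarrow> real \<Rightarrow> real" where
  "u_h n c R \<gamma> = (MAX i\<in>{1..n}. \<gamma> * R i - c i)"

definition min_inspection ::
  "nat \<Rightarrow> (nat \<Rightarrow> real) \<Rightarrow> (nat \<Rightarrow> real) \<Rightarrow> real \<Rightarrow> real \<Rightarrow> real \<Rightarrow> real"
where
  "min_inspection n c R \<kappa> \<alpha> \<gamma> =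
     (THE b. b \<in> {0..1} \<and>
        (\<forall>\<beta>\<in>{0..1}. (\<exists>i\<in>{1..n}. implements n c R \<kappa> \<alpha> (\<gamma>, \<beta>) (i, True)) \<longleftrightarrow> b \<le> \<beta>))"

text \<open>
  The next lemmas show that the point where \<^const>\<open>u_h\<close> attains \<open>\<kappa>\<close> exists and that the
  description in \<^const>\<open>min_inspection\<close> is satisfied by exactly one number from that point on.
  The point itself is unique if \<open>\<kappa> > 0\<close>; for \<open>\<kappa> = 0\<close> it need not be.
\<close>

lemma continuous_on_Max_image:
  fixes f :: "'i \<Rightarrow> real \<Rightarrow> real"
  assumes "finite A" "A \<noteq> {}" "\<And>i. i \<in> A \<Longrightarrow> continuous_on S (f i)"
  shows "continuous_on S (\<lambda>x. MAX i\<in>A. f i x)"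
  using assms
proof (induction A rule: finite_ne_induct)
  case (singleton i)
  then show ?case by simp
next
  case (insert i A)
  then have "continuous_on S (\<lambda>x. max (f i x) (MAX i\<in>A. f i x))"
    by (intro continuous_on_max) auto
  with insert.hyps show ?case by simp
qed

lemma continuous_on_u_h: "1 \<le> n \<Longrightarrow> continuous_on S (u_h n c R)"
  unfolding u_h_def [abs_def]
  by (intro continuous_on_Max_image continuous_intros) auto

lemma u_h_ge: "i \<in> {1..n} \<Longrightarrow> \<gamma> * R i - c i \<le> u_h n c R \<gamma>"
  unfolding u_h_def by (rule Max_ge) auto

lemma u_h_le_iff:
  "1 \<le> n \<Longrightarrow> u_h n c R \<gamma> \<le> t \<longleftrightarrow> (\<forall>i\<in>{1..n}. \<gamma> * R i - c i \<le> t)"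
  unfolding u_h_def by (subst Max_le_iff) auto

lemma u_h_attained:
  assumes "1 \<le> n"
  obtains i where "i \<in> {1..n}" "u_h n c R \<gamma> = \<gamma> * R i - c i"
proof -
  have "u_h n c R \<gamma> \<in> (\<lambda>i. \<gamma> * R i - c i) ` {1..n}"
    unfolding u_h_def using assms by (intro Max_in) auto
  then show thesis using that by auto
qed

lemma u_h_mono:
  assumes "1 \<le> n" "\<And>i. i \<in> {1..n} \<Longrightarrow> 0 \<le> R i" "x \<le> y"
  shows "u_h n c R x \<le> u_h n c R y"
proof -
  have "x * R i - c i \<le> u_h n c R y" if "i \<in> {1..n}" for i
    using u_h_ge [OF that, of y R c] mult_right_mono [OF \<open>x \<le> y\<close> assms(2) [OF that]] by linarith
  then show ?thesis using assms(1) by (simp add: u_h_le_iff)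
qed

lemma ex_u_h_eq:
  assumes "1 \<le> n" "\<And>i. i \<in> {1..n} \<Longrightarrow> 0 \<le> c i" "0 \<le> \<kappa>"
    and "\<kappa> < (MAX i\<in>{1..n}. R i - c i)"
  shows "\<exists>\<gamma>\<in>{0..1}. u_h n c R \<gamma> = \<kappa>"
proof -
  have "u_h n c R 0 \<le> \<kappa>"
    using assms(1-3) by (simp add: u_h_le_iff) (metis assms(2) atLeastAtMost_iff neg_le_0_iff_le One_nat_def order_trans)
  moreover have "\<kappa> \<le> u_h n c R 1" using assms(4) by (simp add: u_h_def)
  ultimately have "\<exists>x. 0 \<le> x \<and> x \<le> 1 \<and> u_h n c R x = \<kappa>"
    using assms(1) by (intro IVT' continuous_on_u_h) auto
  then show ?thesis by auto
qed

lemma safe_implementable_iff: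
  assumes "1 \<le> n"
  shows "(\<exists>i\<in>{1..n}. implements n c R \<kappa> \<alpha> (\<gamma>, \<beta>) (i, True)) \<longleftrightarrow>
    0 \<le> u_h n c R \<gamma> - \<kappa> \<and> u_h n c R ((1 - \<beta>) * (1 - \<alpha>) * \<gamma>) \<le> u_h n c R \<gamma> - \<kappa>"
proof
  assume "\<exists>i\<in>{1..n}. implements n c R \<kappa> \<alpha> (\<gamma>, \<beta>) (i, True)"
  then obtain i where i: "i \<in> {1..n}" "implements n c R \<kappa> \<alpha> (\<gamma>, \<beta>) (i, True)" by blast
  have "agent_utility c R \<kappa> \<alpha> (\<gamma>, \<beta>) (j, False) \<le> agent_utility c R \<kappa> \<alpha> (\<gamma>, \<beta>) (i, True)"
    if "j \<in> {1..n}" for j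
    using i(2) that unfolding implements_def by blast
  moreover have "0 \<le> agent_utility c R \<kappa> \<alpha> (\<gamma>, \<beta>) (i, True)"
    using i(2) unfolding implements_def by blast
  ultimately show "0 \<le> u_h n c R \<gamma> - \<kappa> \<and>
      u_h n c R ((1 - \<beta>) * (1 - \<alpha>) * \<gamma>) \<le> u_h n c R \<gamma> - \<kappa>"
    unfolding u_h_le_iff [OF assms] using u_h_ge [OF i(1), of \<gamma> R c] by fastforce
next
  assume *: "0 \<le> u_h n c R \<gamma> - \<kappa> \<and> u_h n c R ((1 - \<beta>) * (1 - \<alpha>) * \<gamma>) \<le> u_h n c R \<gamma> - \<kappa>"
  obtain i where i: "i \<in> {1..n}" "u_h n c R \<gamma> = \<gamma> * R i - c i"
    using u_h_attained [OF assms] by metis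
  have "agent_utility c R \<kappa> \<alpha> (\<gamma>, \<beta>) (j, s) \<le> agent_utility c R \<kappa> \<alpha> (\<gamma>, \<beta>) (i, True)"
    if "j \<in> {1..n}" for j s
    using * i(2) u_h_ge [OF that, of \<gamma> R c] u_h_ge [OF that, of "(1 - \<beta>) * (1 - \<alpha>) * \<gamma>" R c]
    by (cases s) auto
  then show "\<exists>i\<in>{1..n}. implements n c R \<kappa> \<alpha> (\<gamma>, \<beta>) (i, True)"
    unfolding implements_def using * i by (intro bexI [of _ i]) auto
qed

lemma ex1_min_inspection:
  assumes "1 \<le> n" "\<And>i. i \<in> {1..n} \<Longrightarrow> 0 \<le> c i" "\<And>i. i \<in> {1..n} \<Longrightarrow> 0 \<le> R i"
    and "\<alpha> \<in> {0<..1}" "u_h n c R \<gamma>1 = \<kappa>" "0 \<le> \<gamma>1" "\<gamma> \<in> {\<gamma>1..1}"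
  shows "\<exists>!b. b \<in> {0..1} \<and>
     (\<forall>\<beta>\<in>{0..1}. (\<exists>i\<in>{1..n}. implements n c R \<kappa> \<alpha> (\<gamma>, \<beta>) (i, True)) \<longleftrightarrow> b \<le> \<beta>)"
proof -
  let ?h = "u_h n c R"
  let ?g = "\<lambda>\<beta>. (1 - \<beta>) * (1 - \<alpha>) * \<gamma>"
  have \<gamma>: "0 \<le> \<gamma>" "0 \<le> ?h \<gamma> - \<kappa>"
    using assms u_h_mono [of n R \<gamma>1 \<gamma> c] by auto
  define S where "S = {\<beta> \<in> {0..1}. ?h (?g \<beta>) \<le> ?h \<gamma> - \<kappa>}"
  have S_iff: "\<beta> \<in> S \<longleftrightarrow> (\<exists>i\<in>{1..n}. implements n c R \<kappa> \<alpha> (\<gamma>, \<beta>) (i, True))"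
    if "\<beta> \<in> {0..1}" for \<beta>
    using that \<gamma> by (simp only: safe_implementable_iff [OF assms(1)] S_def) simp
  have "?h 0 \<le> 0" using assms(1,2) by (auto simp: u_h_le_iff)
  then have "1 \<in> S" using \<gamma> by (simp add: S_def)
  have "continuous_on {0..1} (\<lambda>\<beta>. ?h (?g \<beta>))"
    by (rule continuous_on_compose2 [OF continuous_on_u_h [OF assms(1), of UNIV]])
       (auto intro!: continuous_intros)
  then have "closed S"
    unfolding S_def by (intro continuous_on_closed_Collect_le continuous_intros) auto
  moreover have "bdd_below S" unfolding S_def by (rule bdd_belowI [of _ 0]) auto
  ultimately have "Inf S \<in> S" using \<open>1 \<in> S\<close> by (intro closed_contains_Inf) auto
  have up: "y \<in> S" if "x \<in> S" "x \<le> y" "y \<le> 1" for x y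
  proof -
    have "?g y \<le> ?g x" using that \<gamma> assms(4) by (intro mult_right_mono) auto
    then have "?h (?g y) \<le> ?h (?g x)" using assms(1,3) by (intro u_h_mono) auto
    then show ?thesis using that by (auto simp: S_def)
  qed
  have "\<beta> \<in> S \<longleftrightarrow> Inf S \<le> \<beta>" if "\<beta> \<in> {0..1}" for \<beta>
    using that up [OF \<open>Inf S \<in> S\<close>] cInf_lower [OF _ \<open>bdd_below S\<close>] by auto
  then have Inf_iff: "\<forall>\<beta>\<in>{0..1}. (\<exists>i\<in>{1..n}. implements n c R \<kappa> \<alpha> (\<gamma>, \<beta>) (i, True)) \<longleftrightarrow> Inf S \<le> \<beta>"
    using S_iff by blast
  show ?thesis
  proof (rule ex1I [of _ "Inf S"])
    show "Inf S \<in> {0..1} \<and> (\<forall>\<beta>\<in>{0..1}. (\<exists>i\<in>{1..n}. implements n c R \<kappa> \<alpha> (\<gamma>, \<beta>) (i, True)) \<longleftrightarrow> Inf S \<le> \<beta>)"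
      using Inf_iff \<open>Inf S \<in> S\<close> by (simp add: S_def)
  next
    fix b
    assume b: "b \<in> {0..1} \<and> (\<forall>\<beta>\<in>{0..1}. (\<exists>i\<in>{1..n}. implements n c R \<kappa> \<alpha> (\<gamma>, \<beta>) (i, True)) \<longleftrightarrow> b \<le> \<beta>)"
    moreover have "Inf S \<in> {0..1}" using \<open>Inf S \<in> S\<close> by (simp add: S_def)
    ultimately have "Inf S \<le> b" "b \<le> Inf S" using Inf_iff by blast+
    then show "b = Inf S" by simp
  qed
qed

end

(*
  Let h = u_h. By convexity, (h x - h (t x)) / x is nondecreasing in x > 0 for every t in [0, 1],
  and with t = (1 - \<beta>) (1 - \<alpha>) the contract (x, \<beta>) implements a safe action iff
  h x - h (t x) \<ge> \<kappa> and h x \<ge> \<kappa>. So an inspection probability that suffices at x also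
  suffices at every y > x. If the minimal probability is the same positive number at x and y, the
  constraint binds at both points, and \<kappa> / x \<le> \<kappa> / y forces \<kappa> = 0; but then no
  inspection is needed.
*)
theory Submission
  imports Defs
begin

text \<open>An exchange argument on maximizers: with \<open>i\<close> optimal at \<open>x\<close>
  and \<open>j\<close> optimal at \<open>t * y\<close>, one of the two suboptimal choices at
  \<open>t * x\<close> and \<open>y\<close> always gives the bound, depending on which effort is
  costlier. Multiplying out the quotients keeps \<open>x = 0\<close> admissible.\<close>

lemma u_h_diff_scaled:
  assumes n: "1 \<le> n" and t: "0 \<le> t" "t \<le> 1" and x: "0 \<le> x" "x \<le> y"
  shows "y * (u_h n c R x - u_h n c R (t * x)) \<le> x * (u_h n c R y - u_h n c R (t * y))"
proof -
  let ?h = "u_h n c R"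
  obtain i where i: "i \<in> {1..n}" "?h x = x * R i - c i" using u_h_attained [OF n] by metis
  obtain j where j: "j \<in> {1..n}" "?h (t * y) = t * y * R j - c j" using u_h_attained [OF n] by metis
  show ?thesis
  proof (cases "c j \<le> c i")
    case True
    have "y * (?h x - ?h (t * x)) \<le> y * ((x * R i - c i) - (t * x * R j - c j))"
      using x i(2) u_h_ge [OF j(1), of "t * x" R c] by (intro mult_left_mono) auto
    also have "\<dots> \<le> x * ((y * R i - c i) - (t * y * R j - c j))"
      \<comment> \<open>The reward terms agree on both sides, leaving
        \<open>y * (c j - c i) \<le> x * (c j - c i)\<close> with a nonpositive factor.\<close>
      using mult_right_mono [OF \<open>x \<le> y\<close>, of "c i - c j"] True by (simp add: algebra_simps)
    also have "\<dots> \<le> x * (?h y - ?h (t * y))"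
      using x j(2) u_h_ge [OF i(1), of y R c] by (intro mult_left_mono) auto
    finally show ?thesis .
  next
    case False
    \<comment> \<open>At \<open>t * y\<close> the costlier \<open>j\<close> is still optimal, so its
      reward must make up for the extra cost.\<close>
    then have "0 < (t * y) * (R j - R i)"
      using u_h_ge [OF i(1), of "t * y" R c] j(2) by (simp add: right_diff_distrib)
    moreover have "0 \<le> t * y" using t x by simp
    ultimately have R: "R i \<le> R j" by (simp add: zero_less_mult_iff)
    have "y * (?h x - ?h (t * x)) \<le> y * ((x * R i - c i) - (t * x * R i - c i))"
      using x i(2) u_h_ge [OF i(1), of "t * x" R c] by (intro mult_left_mono) auto
    also have "\<dots> = ((1 - t) * x * y) * R i" by (simp add: algebra_simps)
    also have "\<dots> \<le> ((1 - t) * x * y) * R j" using R t x by (intro mult_left_mono) auto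
    also have "\<dots> = x * ((y * R j - c j) - (t * y * R j - c j))" by (simp add: algebra_simps)
    also have "\<dots> \<le> x * (?h y - ?h (t * y))"
      using x j(2) u_h_ge [OF j(1), of y R c] by (intro mult_left_mono) auto
    finally show ?thesis .
  qed
qed

text \<open>Gathers what makes the definite description in \<open>min_inspection\<close> well
  defined from \<gamma>1 on.\<close>

locale inspection_model =
  fixes n :: nat and c R :: "nat \<Rightarrow> real" and \<kappa> \<alpha> \<gamma>1 :: real
  assumes n: "1 \<le> n"
    and c: "\<And>i. i \<in> {1..n} \<Longrightarrow> 0 \<le> c i"
    and R: "\<And>i. i \<in> {1..n} \<Longrightarrow> 0 \<le> R i"
    and \<alpha>: "\<alpha> \<in> {0<..1}"
    and \<gamma>1: "0 \<le> \<gamma>1" "u_h n c R \<gamma>1 = \<kappa>"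
begin

lemma min_inspection_spec:
  assumes "\<gamma> \<in> {\<gamma>1..1}"
  shows "min_inspection n c R \<kappa> \<alpha> \<gamma> \<in> {0..1} \<and>
    (\<forall>\<beta>\<in>{0..1}. (\<exists>i\<in>{1..n}. implements n c R \<kappa> \<alpha> (\<gamma>, \<beta>) (i, True)) \<longleftrightarrow>
      min_inspection n c R \<kappa> \<alpha> \<gamma> \<le> \<beta>)"
  unfolding min_inspection_def
  by (rule theI', rule ex1_min_inspection [where ?\<gamma>1.0 = \<gamma>1]) (use n c R \<alpha> \<gamma>1 assms in auto)

lemma min_inspection_range:
  assumes \<gamma>: "\<gamma> \<in> {\<gamma>1..1}"
  shows "min_inspection n c R \<kappa> \<alpha> \<gamma> \<in> {0..1}"
  using min_inspection_spec [OF \<gamma>] by simp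

text \<open>Since \<open>u_h\<close> is monotone, its value is at least \<kappa> from \<gamma>1 on,
  so individual rationality is automatic and only the comparison with the best unsafe action
  remains.\<close>

lemma min_inspection_le_iff:
  assumes \<gamma>: "\<gamma> \<in> {\<gamma>1..1}" and \<beta>: "\<beta> \<in> {0..1}"
  shows "min_inspection n c R \<kappa> \<alpha> \<gamma> \<le> \<beta> \<longleftrightarrow>
    u_h n c R ((1 - \<beta>) * (1 - \<alpha>) * \<gamma>) \<le> u_h n c R \<gamma> - \<kappa>"
proof -
  have "0 \<le> u_h n c R \<gamma> - \<kappa>"
    using \<gamma> \<gamma>1 u_h_mono [of n R \<gamma>1 \<gamma> c] n R by auto
  moreover have "min_inspection n c R \<kappa> \<alpha> \<gamma> \<le> \<beta> \<longleftrightarrow>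
      (\<exists>i\<in>{1..n}. implements n c R \<kappa> \<alpha> (\<gamma>, \<beta>) (i, True))"
    using min_inspection_spec [OF \<gamma>] \<beta> by blast
  ultimately show ?thesis by (simp only: safe_implementable_iff [OF n]) simp
qed

text \<open>Every smaller probability in the unit interval violates the constraint, so by continuity
  the reverse inequality survives in the limit from the left.\<close>

lemma min_inspection_binding:
  assumes \<gamma>: "\<gamma> \<in> {\<gamma>1..1}"
    and pos: "0 < min_inspection n c R \<kappa> \<alpha> \<gamma>"
  shows "u_h n c R ((1 - min_inspection n c R \<kappa> \<alpha> \<gamma>) * (1 - \<alpha>) * \<gamma>) = u_h n c R \<gamma> - \<kappa>"
proof (rule antisym)
  let ?b = "min_inspection n c R \<kappa> \<alpha> \<gamma>"
  let ?f = "\<lambda>\<beta>. u_h n c R ((1 - \<beta>) * (1 - \<alpha>) * \<gamma>)"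
  note le_iff = min_inspection_le_iff [OF \<gamma>]
  have b: "?b \<in> {0..1}" by (rule min_inspection_range [OF \<gamma>])
  show "?f ?b \<le> u_h n c R \<gamma> - \<kappa>" using le_iff [OF b] by simp
  have "continuous_on UNIV ?f"
    by (rule continuous_on_compose2 [OF continuous_on_u_h [OF n, of UNIV]])
       (auto intro!: continuous_intros)
  then have "(?f \<longlongrightarrow> ?f ?b) (at_left ?b)"
    by (auto simp: continuous_on_eq_continuous_within continuous_within intro: tendsto_within_subset)
  \<comment> \<open>Positivity of \<open>?b\<close> makes the interval from 0 to \<open>?b\<close> a
    left neighbourhood, and there \<open>le_iff\<close> fails.\<close>
  moreover have "\<forall>\<^sub>F \<beta> in at_left ?b. u_h n c R \<gamma> - \<kappa> \<le> ?f \<beta>"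
    using eventually_at_left_real [OF pos]
  proof eventually_elim
    case (elim \<beta>)
    then show ?case using b le_iff [of \<beta>] by auto
  qed
  ultimately show "u_h n c R \<gamma> - \<kappa> \<le> ?f ?b"
    by (rule tendsto_lowerbound) simp
qed

end

theorem lemma2:
  fixes n :: nat and c R :: "nat \<Rightarrow> real" and \<kappa> \<alpha> \<gamma>1 :: real
  assumes "1 \<le> n"
    and "\<And>i. i \<in> {1..n} \<Longrightarrow> 0 \<le> c i"
    and "\<And>i. i \<in> {1..n} \<Longrightarrow> 0 \<le> R i"
    and "0 \<le> \<kappa>"
    and "\<alpha> \<in> {0<..1}"
    and "strict_mono_on {1..n} c"
    and "strict_mono_on {1..n} R"
    and "(MAX i\<in>{1..n}. R i - c i) > \<kappa>"
    and "\<gamma>1 \<in> {0..1}"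
    and "u_h n c R \<gamma>1 = \<kappa>"
  shows "antimono_on {\<gamma>1..1} (min_inspection n c R \<kappa> \<alpha>) \<and>
         strict_antimono_on {\<gamma> \<in> {\<gamma>1..1}. min_inspection n c R \<kappa> \<alpha> \<gamma> > 0}
           (min_inspection n c R \<kappa> \<alpha>)"
proof -
  let ?h = "u_h n c R" and ?b = "min_inspection n c R \<kappa> \<alpha>"
  interpret inspection_model n c R \<kappa> \<alpha> \<gamma>1
    by unfold_locales (use assms in auto)
  note le_iff = min_inspection_le_iff and range = min_inspection_range
    and binding = min_inspection_binding
  have h0: "?h 0 \<le> 0" using assms(1,2) by (auto simp: u_h_le_iff)
  \<comment> \<open>If \<gamma>1 were 0, then \<kappa> would equal \<open>?h 0\<close>, which is at
    most 0.\<close>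
  have pos: "0 < x" if "x \<in> {\<gamma>1..1}" "0 < \<kappa>" for x
    using that \<gamma>1 h0 by (cases "\<gamma>1 = 0") auto
  have scaled: "y * (?h x - ?h ((1 - \<beta>) * (1 - \<alpha>) * x)) \<le> x * (?h y - ?h ((1 - \<beta>) * (1 - \<alpha>) * y))"
    if "0 \<le> x" "x \<le> y" "\<beta> \<in> {0..1}" for x y \<beta>
    using that assms(5) by (intro u_h_diff_scaled [OF assms(1)]) (auto intro: mult_le_one)
  have zero: "?b x = 0" if x: "x \<in> {\<gamma>1..1}" and "\<kappa> = 0" for x
  proof -
    have "(1 - \<alpha>) * x \<le> x" using x \<gamma>1 assms(5) by (intro mult_left_le_one_le) auto
    then have "?h ((1 - \<alpha>) * x) \<le> ?h x" by (intro u_h_mono assms(1,3))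
    then show ?thesis using le_iff [OF x, of 0] range [OF x] \<open>\<kappa> = 0\<close> by simp
  qed
  have anti: "?b y \<le> ?b x" if x: "x \<in> {\<gamma>1..1}" and y: "y \<in> {\<gamma>1..1}" and "x \<le> y" for x y
  proof (cases "\<kappa> = 0")
    case True
    then show ?thesis using zero x y by simp
  next
    case False
    then have \<kappa>: "0 < \<kappa>" using assms(4) by simp
    note x0 = pos [OF x \<kappa>]
    \<comment> \<open>The inspection probability of \<open>x\<close> is kept fixed and shown to
      suffice at \<open>y\<close>; the positive factor \<open>x\<close> is cancelled at the end of
      the chain.\<close>
    let ?t = "(1 - ?b x) * (1 - \<alpha>)"
    have "x * \<kappa> \<le> y * \<kappa>" using \<open>x \<le> y\<close> \<kappa> by simp
    also have "\<dots> \<le> y * (?h x - ?h (?t * x))"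
      using le_iff [OF x range [OF x]] x0 \<open>x \<le> y\<close> by (intro mult_left_mono) auto
    also have "\<dots> \<le> x * (?h y - ?h (?t * y))"
      using scaled [OF _ \<open>x \<le> y\<close> range [OF x]] x0 by simp
    finally have "\<kappa> \<le> ?h y - ?h (?t * y)" using x0 by simp
    then show ?thesis using le_iff [OF y range [OF x]] by simp
  qed
  have strict: "?b y < ?b x"
    if x: "x \<in> {\<gamma>1..1}" "0 < ?b x" and y: "y \<in> {\<gamma>1..1}" "0 < ?b y" and "x < y" for x y
  proof (rule ccontr)
    assume "\<not> ?b y < ?b x"
    then have eq: "?b y = ?b x" using anti [OF x(1) y(1)] \<open>x < y\<close> by simp
    have \<kappa>: "0 < \<kappa>" using zero x assms(4) by (cases "\<kappa> = 0") auto
    \<comment> \<open>Equal probabilities give the same scaling factor at \<open>x\<close> and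
      \<open>y\<close>, and both constraints bind, so both differences in \<open>scaled\<close>
      equal \<kappa>.\<close>
    have "y * \<kappa> \<le> x * \<kappa>"
      using scaled [OF _ less_imp_le [OF \<open>x < y\<close>] range [OF x(1)]] pos [OF x(1) \<kappa>]
        binding [OF x] binding [OF y] eq by simp
    then show False using \<kappa> \<open>x < y\<close> by simp
  qed
  show ?thesis using anti strict by (auto intro!: monotone_onI)
qed

end
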